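(* If $\Lambda\subset\mathbb{D}$ is a sampling set for the Nevanlinna class $\mathcal{N}$, then $\Lambda$ is a Hayman-Lyons set.
   Context: $\mathbb{D}$ is the open unit disk and $\mathbb{T}=\partial\mathbb{D}$. The Nevanlinna class is $\mathcal{N}=\{f\in \mathrm{Hol}(\mathbb{D}):\lim_{r\to1}\frac1{2\pi}\int_0^{2\pi}\log^+|f(re^{i\theta})|\,d\theta<\infty\}$. $\mathrm{Har}_+(\mathbb{D})$ is the set of non-negative harmonic functions on $\mathbb{D}$, and $\mathrm{Har}_\pm(\mathbb{D})=\{h_1-h_2:h_1,h_2\in\mathrm{Har}_+(\mathbb{D})\}$. For $f\in\mathcal{N}$ put $N(f)=\inf\{h(0): h\in\mathrm{Har}_+(\mathbb{D}),\ \log(1+|f|)\le h \text{ on } \mathbb{D}\}$ and $N(f|\Lambda)=\inf\{h(0): h\in\mathrm{Har}_+(\mathbb{D}),\ \log(1+|f(\lambda)|)\le h(\lambda)\ \forall\lambda\in\Lambda\}$. $\Lambda$ is sampling for $\mathcal{N}$ if there exists $C>0$ such that $N(f)\le N(f|\Lambda)+C$ for all $f\in\mathcal{N}$. Let $\rho(z,w)=\left|\frac{z-w}{1-z\bar w}\right|$, $D(z,r)=\{w\in\mathbb{D}:\rho(z,w)<r\}$ for $r\in(0,1)$, $\Lambda^\delta=\bigcup_{\lambda\in\Lambda}D(\lambda,\delta)$ and, for $\zeta\in\mathbb{T}$, $I(\Lambda,\zeta,\delta)=\int_{\Lambda^\delta}\frac{1}{|\zeta-z|^2}\,dm(z)$,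 with $m$ the area measure. $\Lambda$ is a Hayman-Lyons set if there exists $\delta\in(0,1)$ such that $I(\Lambda,\zeta,\delta)=\infty$ for all $\zeta\in\mathbb{T}$. By a known theorem of Hayman and Lyons this is equivalent to: $\sup_\Lambda h=\sup_{\mathbb{D}}h$ for all $h\in\mathrm{Har}_\pm(\mathbb{D})$. *)

theory Defs
  imports "HOL-Analysis.Analysis"
begin

abbreviation unit_disk :: "complex set" where
  "unit_disk \<equiv> ball 0 1"

abbreviation unit_circle :: "complex set" where
  "unit_circle \<equiv> sphere 0 1"

text \<open>
  Classical harmonicity on an open set: \<open>u\<close> is twice continuously differentiable and its Laplacian
  vanishes. Here \<open>ux, uy\<close> are the first and \<open>uxx, uxy, uyx, uyy\<close> the second partial derivatives.
\<close>
definition harmonic_on :: "(complex \<Rightarrow> real) \<Rightarrow> complex set \<Rightarrow> bool" where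
  "harmonic_on u S \<longleftrightarrow>
    (\<exists>ux uy uxx uxy uyx uyy :: complex \<Rightarrow> real.
      continuous_on S uxx \<and> continuous_on S uxy \<and> continuous_on S uyx \<and> continuous_on S uyy \<and>
      (\<forall>z\<in>S. (u has_derivative (\<lambda>v. ux z * Re v + uy z * Im v)) (at z) \<and>
             (ux has_derivative (\<lambda>v. uxx z * Re v + uxy z * Im v)) (at z) \<and>
             (uy has_derivative (\<lambda>v. uyx z * Re v + uyy z * Im v)) (at z) \<and>
             uxx z + uyy z = 0))"

definition Har_plus :: "(complex \<Rightarrow> real) set" where
  "Har_plus = {h. harmonic_on h unit_disk \<and> (\<forall>z\<in>unit_disk. 0 \<le> h z)}"

text \<open>Since \<open>ln 0 = 0\<close> for reals, this also gives the intended value \<open>log_plus 0 = 0\<close>.\<close>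
definition log_plus :: "real \<Rightarrow> real" where
  "log_plus x = max 0 (ln x)"

text \<open>
  The circular means are non-decreasing in \<open>r\<close> for holomorphic \<open>f\<close>, so their limit always exists in
  \<open>[0, \<infinity>]\<close>; that it is finite is expressed by convergence to some real \<open>L\<close>.
\<close>
definition Nevanlinna :: "(complex \<Rightarrow> complex) set" where
  "Nevanlinna = {f. f holomorphic_on unit_disk \<and>
     (\<exists>L::real. ((\<lambda>r::real. 1 / (2 * pi) *
          integral {0..2 * pi} (\<lambda>\<theta>. log_plus (cmod (f (of_real r * cis \<theta>))))) \<longlongrightarrow> L)
        (at_left 1))}"

text \<open>The infima are taken in \<^typ>\<open>ereal\<close>, so that the infimum over the empty set is \<open>\<infinity>\<close>.\<close>
definition Nev_on :: "complex set \<Rightarrow> (complex \<Rightarrow> complex) \<Rightarrow> ereal" where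
  "Nev_on \<Lambda> f = (INF h\<in>{h \<in> Har_plus. \<forall>z\<in>\<Lambda>. ln (1 + cmod (f z)) \<le> h z}. ereal (h 0))"

definition Nev :: "(complex \<Rightarrow> complex) \<Rightarrow> ereal" where
  "Nev f = (INF h\<in>{h \<in> Har_plus. \<forall>z\<in>unit_disk. ln (1 + cmod (f z)) \<le> h z}. ereal (h 0))"

definition sampling_Nevanlinna :: "complex set \<Rightarrow> bool" where
  "sampling_Nevanlinna \<Lambda> \<longleftrightarrow> (\<exists>C::real. C > 0 \<and> (\<forall>f\<in>Nevanlinna. Nev f \<le> Nev_on \<Lambda> f + ereal C))"

definition pseudohyp_dist :: "complex \<Rightarrow> complex \<Rightarrow> real" where
  "pseudohyp_dist z w = cmod ((z - w) / (1 - z * cnj w))"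

definition pseudohyp_ball :: "complex \<Rightarrow> real \<Rightarrow> complex set" where
  "pseudohyp_ball z r = {w \<in> unit_disk. pseudohyp_dist z w < r}"

definition pseudohyp_nbhd :: "complex set \<Rightarrow> real \<Rightarrow> complex set" where
  "pseudohyp_nbhd \<Lambda> \<delta> = (\<Union>a\<in>\<Lambda>. pseudohyp_ball a \<delta>)"

definition Hayman_Lyons_integral :: "complex set \<Rightarrow> complex \<Rightarrow> real \<Rightarrow> ennreal" where
  "Hayman_Lyons_integral \<Lambda> \<zeta> \<delta> =
     (\<integral>\<^sup>+z\<in>pseudohyp_nbhd \<Lambda> \<delta>. ennreal (1 / (cmod (\<zeta> - z))\<^sup>2) \<partial>lborel)"

definition Hayman_Lyons_set :: "complex set \<Rightarrow> bool" where
  "Hayman_Lyons_set \<Lambda> \<longleftrightarrow>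
     (\<exists>\<delta>::real. 0 < \<delta> \<and> \<delta> < 1 \<and> (\<forall>\<zeta>\<in>unit_circle. Hayman_Lyons_integral \<Lambda> \<zeta> \<delta> = \<infinity>))"

end

theory Submission
  imports Defs "HOL-Complex_Analysis.Complex_Analysis"
begin

text \<open>
  The contrapositive holds for one concrete radius. Suppose that the Hayman--Lyons integral with
  \<open>\<delta> = 1/2\<close> is finite at some \<open>\<zeta>\<close> on the circle, and let \<open>P\<close> be the Poisson kernel with pole \<open>\<zeta>\<close>.

  Finiteness makes \<open>40 / |\<zeta> - w|^2\<close>, restricted to a union \<open>U\<close> of small discs around the points of
  \<open>\<Lambda>\<close>, the density of a finite measure \<open>M\<close>. Average over \<open>M\<close> the positive harmonic functions
  \<open>z \<mapsto> Re ((1 + cnj w z) / (1 - cnj w z))\<close>, whose poles lie outside the closed disc when \<open>|w| < 1\<close>.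
  The result is a positive harmonic function \<open>h\<close>. At a point \<open>a\<close> of \<open>\<Lambda>\<close> the disc of \<open>U\<close> around
  \<open>a\<close> alone contributes at least \<open>P a\<close>, so \<open>P \<le> h\<close> on \<open>\<Lambda>\<close>
  (\<open>Poisson_dominated_by_herglotz\<close>). But \<open>M\<close> has no mass on the circle, so \<open>h\<close> grows more slowly
  than \<open>P\<close> along the radius to \<open>\<zeta>\<close>, and \<open>h z < P z\<close> for some \<open>z\<close>
  (\<open>herglotz_less_Poisson_radially\<close>).

  Now let \<open>f\<close> be a holomorphic function with \<open>ln |f| = c (P - h)\<close>. On \<open>\<Lambda>\<close> it is bounded by 1, so the
  constant \<open>ln 2\<close> is an admissible majorant and \<open>Nev_on \<Lambda> f \<le> ln 2\<close> for every \<open>c\<close>. A majorant on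
  the whole disc is at least \<open>c (P z - h z)\<close> at \<open>z\<close>, hence by Harnack's inequality at least a fixed
  multiple of \<open>c\<close> at 0. Letting \<open>c\<close> grow contradicts sampling.

  Two points need work. Harnack's inequality has to be derived for functions that are harmonic in the
  sense of partial derivatives; such a function is the real part of a holomorphic one, and the
  inequality is then Schwarz's lemma. And \<open>f\<close> must lie in the Nevanlinna class, where the circular
  means have to converge and not merely be bounded: the mean of \<open>(P - h)^+ = P - min P h\<close> is 1 minus
  that of \<open>min P h\<close>, which tends to 0 because \<open>h\<close> is a bounded function plus a positive harmonic
  function of small mean, while \<open>P\<close> tends to 0 off \<open>\<zeta>\<close>.
\<close>

section \<open>Harnack's inequality for harmonic functions\<close>

text \<open>
  The mean value theorem, applied along \<open>a\<close> to \<open>u (_ + t b) - u\<close> and then along \<open>b\<close> to the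
  resulting derivative. Its left-hand side is symmetric in \<open>a\<close> and \<open>b\<close>, which makes mixed partial
  derivatives agree.
\<close>
lemma second_difference_mean_value:
  fixes u :: "'a::real_normed_vector \<Rightarrow> real"
  assumes u: "\<And>w. w \<in> ball z e \<Longrightarrow> (u has_derivative u' w) (at w)"
    and v: "\<And>w. w \<in> ball z e \<Longrightarrow> ((\<lambda>w. u' w a) has_derivative v' w) (at w)"
    and t: "0 < t" "t * (norm a + norm b) < e"
  shows "\<exists>p. norm (p - z) \<le> t * (norm a + norm b) \<and>
    u (z + t *\<^sub>R a + t *\<^sub>R b) - u (z + t *\<^sub>R a) - u (z + t *\<^sub>R b) + u z = t\<^sup>2 * v' p b"
proof -
  have near: "norm ((z + x *\<^sub>R a + y *\<^sub>R b) - z) \<le> t * (norm a + norm b)"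
    if "0 \<le> x" "x \<le> t" "0 \<le> y" "y \<le> t" for x y
  proof -
    have "norm ((z + x *\<^sub>R a + y *\<^sub>R b) - z) \<le> x * norm a + y * norm b"
      using norm_triangle_ineq[of "x *\<^sub>R a" "y *\<^sub>R b"] that by (simp add: algebra_simps)
    also have "\<dots> \<le> t * norm a + t * norm b"
      using that by (intro add_mono mult_right_mono) auto
    finally show ?thesis by (simp add: algebra_simps)
  qed
  have inb: "z + x *\<^sub>R a + y *\<^sub>R b \<in> ball z e" if "0 \<le> x" "x \<le> t" "0 \<le> y" "y \<le> t" for x y
    unfolding mem_ball dist_norm norm_minus_commute[of z] by (rule le_less_trans[OF near[OF that] t(2)])
  define \<phi> where "\<phi> = (\<lambda>x. u (z + x *\<^sub>R a + t *\<^sub>R b) - u (z + x *\<^sub>R a + 0 *\<^sub>R b))"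
  have line: "((\<lambda>x. u (z + x *\<^sub>R a + y *\<^sub>R b)) has_real_derivative u' (z + x *\<^sub>R a + y *\<^sub>R b) a) (at x)"
    if "0 \<le> x" "x \<le> t" "0 \<le> y" "y \<le> t" for x y
  proof -
    have "((\<lambda>x. u (z + x *\<^sub>R a + y *\<^sub>R b)) has_derivative (\<lambda>s. u' (z + x *\<^sub>R a + y *\<^sub>R b) (s *\<^sub>R a))) (at x)"
      by (rule has_derivative_compose[where g = u and f = "\<lambda>x. z + x *\<^sub>R a + y *\<^sub>R b", OF _ u[OF inb[OF that]]]) (auto intro!: derivative_eq_intros)
    moreover have "u' (z + x *\<^sub>R a + y *\<^sub>R b) (s *\<^sub>R a) = s * u' (z + x *\<^sub>R a + y *\<^sub>R b) a" for s
      using linear_cmul[OF has_derivative_linear[OF u[OF inb[OF that]]]] by simp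
    ultimately show ?thesis by (simp add: has_field_derivative_def mult_commute_abs)
  qed
  have line2: "((\<lambda>y. u' (z + x *\<^sub>R a + y *\<^sub>R b) a) has_real_derivative v' (z + x *\<^sub>R a + y *\<^sub>R b) b) (at y)"
    if "0 \<le> x" "x \<le> t" "0 \<le> y" "y \<le> t" for x y
  proof -
    have "((\<lambda>y. u' (z + x *\<^sub>R a + y *\<^sub>R b) a) has_derivative (\<lambda>s. v' (z + x *\<^sub>R a + y *\<^sub>R b) (s *\<^sub>R b))) (at y)"
      by (rule has_derivative_compose[where g = "\<lambda>w. u' w a" and f = "\<lambda>y. z + x *\<^sub>R a + y *\<^sub>R b", OF _ v[OF inb[OF that]]]) (auto intro!: derivative_eq_intros)
    moreover have "v' (z + x *\<^sub>R a + y *\<^sub>R b) (s *\<^sub>R b) = s * v' (z + x *\<^sub>R a + y *\<^sub>R b) b" for s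
      using linear_cmul[OF has_derivative_linear[OF v[OF inb[OF that]]]] by simp
    ultimately show ?thesis by (simp add: has_field_derivative_def mult_commute_abs)
  qed
  obtain \<xi> where \<xi>: "0 < \<xi>" "\<xi> < t" "\<phi> t - \<phi> 0 =
      (t - 0) * (u' (z + \<xi> *\<^sub>R a + t *\<^sub>R b) a - u' (z + \<xi> *\<^sub>R a + 0 *\<^sub>R b) a)"
  proof -
    have "(\<phi> has_real_derivative u' (z + x *\<^sub>R a + t *\<^sub>R b) a - u' (z + x *\<^sub>R a + 0 *\<^sub>R b) a) (at x)"
      if "0 \<le> x" "x \<le> t" for x
      unfolding \<phi>_def using that t(1) by (intro DERIV_diff line) auto
    from MVT2[OF t(1) this] show ?thesis using that by blast
  qed
  obtain \<eta> where \<eta>: "0 < \<eta>" "\<eta> < t"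
    "u' (z + \<xi> *\<^sub>R a + t *\<^sub>R b) a - u' (z + \<xi> *\<^sub>R a + 0 *\<^sub>R b) a =
      (t - 0) * v' (z + \<xi> *\<^sub>R a + \<eta> *\<^sub>R b) b"
  proof -
    have "((\<lambda>y. u' (z + \<xi> *\<^sub>R a + y *\<^sub>R b) a) has_real_derivative v' (z + \<xi> *\<^sub>R a + y *\<^sub>R b) b) (at y)"
      if "0 \<le> y" "y \<le> t" for y
      using that \<xi>(1,2) by (intro line2) auto
    from MVT2[OF t(1) this] show ?thesis using that by blast
  qed
  have "\<phi> t - \<phi> 0 = t\<^sup>2 * v' (z + \<xi> *\<^sub>R a + \<eta> *\<^sub>R b) b"
    using \<xi>(3) \<eta>(3) by (simp add: power2_eq_square)
  then have "u (z + t *\<^sub>R a + t *\<^sub>R b) - u (z + t *\<^sub>R a) - u (z + t *\<^sub>R b) + u z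
      = t\<^sup>2 * v' (z + \<xi> *\<^sub>R a + \<eta> *\<^sub>R b) b"
    by (simp add: \<phi>_def)
  then show ?thesis
    using near[of \<xi> \<eta>] \<xi> \<eta> by (intro exI[of _ "z + \<xi> *\<^sub>R a + \<eta> *\<^sub>R b"]) auto
qed

lemma mixed_partials_eq:
  fixes u ux uy uxx uxy uyx uyy :: "complex \<Rightarrow> real"
  assumes S: "open S" "z \<in> S"
    and u: "\<And>w. w \<in> S \<Longrightarrow> (u has_derivative (\<lambda>v. ux w * Re v + uy w * Im v)) (at w)"
    and ux: "\<And>w. w \<in> S \<Longrightarrow> (ux has_derivative (\<lambda>v. uxx w * Re v + uxy w * Im v)) (at w)"
    and uy: "\<And>w. w \<in> S \<Longrightarrow> (uy has_derivative (\<lambda>v. uyx w * Re v + uyy w * Im v)) (at w)"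
    and cont: "continuous_on S uxy" "continuous_on S uyx"
  shows "uxy z = uyx z"
proof (rule ccontr)
  assume ne: "uxy z \<noteq> uyx z"
  define d where "d = dist (uxy z) (uyx z) / 2"
  have d: "d > 0" using ne by (simp add: d_def)
  obtain e where e: "e > 0" "ball z e \<subseteq> S" using S by (meson openE)
  have "isCont uxy z" "isCont uyx z" using cont S by (auto simp: continuous_on_eq_continuous_at)
  then obtain e1 e2 where
    e1: "e1 > 0" "\<And>w. dist w z < e1 \<Longrightarrow> dist (uxy w) (uxy z) < d" and
    e2: "e2 > 0" "\<And>w. dist w z < e2 \<Longrightarrow> dist (uyx w) (uyx z) < d"
    using d unfolding continuous_at_eps_delta by metis
  define t where "t = Min {e, e1, e2} / 3"
  have t: "t > 0" "t * (norm (1::complex) + norm \<i>) < e" "t * 2 < e1" "t * 2 < e2"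
    using e(1) e1(1) e2(1) by (auto simp: t_def)
  have t': "t * (norm \<i> + norm (1::complex)) < e" using t by simp
  have inS: "w \<in> S" if "dist z w < e" for w using e(2) that by auto
  obtain p where p: "norm (p - z) \<le> t * 2"
    "u (z + t *\<^sub>R 1 + t *\<^sub>R \<i>) - u (z + t *\<^sub>R 1) - u (z + t *\<^sub>R \<i>) + u z = t\<^sup>2 * uxy p"
    using second_difference_mean_value[where e = e and z = z and u = u and
        u' = "\<lambda>w v. ux w * Re v + uy w * Im v" and v' = "\<lambda>w v. uxx w * Re v + uxy w * Im v",
        OF u _ t(1,2), simplified, OF inS ux[OF inS]] by blast
  obtain q where q: "norm (q - z) \<le> t * 2"
    "u (z + t *\<^sub>R \<i> + t *\<^sub>R 1) - u (z + t *\<^sub>R \<i>) - u (z + t *\<^sub>R 1) + u z = t\<^sup>2 * uyx q"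
    using second_difference_mean_value[where e = e and z = z and u = u and
        u' = "\<lambda>w v. ux w * Re v + uy w * Im v" and v' = "\<lambda>w v. uyx w * Re v + uyy w * Im v",
        OF u _ t(1) t', simplified, OF inS uy[OF inS]] by blast
  have "t\<^sup>2 * uxy p = t\<^sup>2 * uyx q"
    using p(2) q(2) by (simp add: algebra_simps)
  then have eq: "uxy p = uyx q" using t(1) by simp
  have "dist (uxy p) (uxy z) < d" "dist (uyx q) (uyx z) < d"
    using p(1) q(1) t e1(2)[of p] e2(2)[of q] by (auto simp: dist_norm)
  then have "dist (uxy z) (uyx z) < 2 * d"
    using eq dist_triangle_half_l[of "uxy z" "uxy p" "2*d" "uyx z"] by (auto simp: dist_commute)
  then show False by (simp add: d_def)
qed

text \<open>
  Equality of the mixed partials and the vanishing Laplacian are the Cauchy--Riemann equations for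
  \<open>ux - \<i> uy\<close>. On the convex disc this function has a primitive, whose real part has the same gradient
  as \<open>u\<close>.
\<close>
lemma harmonic_on_disk_eq_Re_holomorphic:
  assumes "harmonic_on u unit_disk"
  obtains G where "G holomorphic_on unit_disk" "\<And>z. z \<in> unit_disk \<Longrightarrow> Re (G z) = u z"
proof -
  obtain ux uy uxx uxy uyx uyy where
    cont: "continuous_on unit_disk uxy" "continuous_on unit_disk uyx" and
    u: "\<And>z. z \<in> unit_disk \<Longrightarrow> (u has_derivative (\<lambda>v. ux z * Re v + uy z * Im v)) (at z)" and
    ux: "\<And>z. z \<in> unit_disk \<Longrightarrow> (ux has_derivative (\<lambda>v. uxx z * Re v + uxy z * Im v)) (at z)" and
    uy: "\<And>z. z \<in> unit_disk \<Longrightarrow> (uy has_derivative (\<lambda>v. uyx z * Re v + uyy z * Im v)) (at z)" and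
    lap: "\<And>z. z \<in> unit_disk \<Longrightarrow> uxx z + uyy z = 0"
    using assms unfolding harmonic_on_def by blast
  have sym: "uxy z = uyx z" if "z \<in> unit_disk" for z
    using mixed_partials_eq[OF open_ball that u ux uy cont] .
  define g where "g = (\<lambda>z. complex_of_real (ux z) - \<i> * complex_of_real (uy z))"
  have dg: "(g has_field_derivative (of_real (uxx z) - \<i> * of_real (uyx z))) (at z)"
    if z: "z \<in> unit_disk" for z
  proof -
    have "(g has_derivative (\<lambda>v. of_real (uxx z * Re v + uxy z * Im v)
        - \<i> * of_real (uyx z * Re v + uyy z * Im v))) (at z)"
      unfolding g_def using ux[OF z] uy[OF z]
      by (intro has_derivative_diff has_derivative_mult_right has_derivative_of_real)
    moreover have "(\<lambda>v. of_real (uxx z * Re v + uxy z * Im v)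
        - \<i> * of_real (uyx z * Re v + uyy z * Im v)) = (*) (of_real (uxx z) - \<i> * of_real (uyx z))"
      using sym[OF z] lap[OF z]

      by (auto simp: fun_eq_iff complex_eq_iff algebra_simps)
        (metis add.commute add.inverse_unique mult_minus_right)
    ultimately show ?thesis by (simp add: has_field_derivative_def)
  qed
  have "g holomorphic_on unit_disk"
    unfolding holomorphic_on_open[OF open_ball] by (intro ballI exI) (rule dg)
  then obtain G where G: "\<And>z. z \<in> unit_disk \<Longrightarrow> (G has_field_derivative g z) (at z)"

    using holomorphic_convex_primitive'[OF convex_ball open_ball] at_within_open[OF _ open_ball]
    by metis
  have der0: "((\<lambda>z. Re (G z) - u z) has_derivative (\<lambda>v. 0)) (at z within unit_disk)" if z: "z \<in> unit_disk" for z
  proof -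
    have "((\<lambda>z. Re (G z) - u z) has_derivative
        (\<lambda>v. Re (g z * v) - (ux z * Re v + uy z * Im v))) (at z)"
      using G[OF z] u[OF z] unfolding has_field_derivative_def
      by (intro has_derivative_diff has_derivative_Re)
    then show ?thesis by (auto simp: g_def intro: has_derivative_at_withinI)
  qed
  obtain c where c: "\<And>z. z \<in> unit_disk \<Longrightarrow> Re (G z) - u z = c"
    using has_derivative_zero_constant[OF convex_ball der0] by auto
  show ?thesis
  proof (rule that[of "\<lambda>z. G z - of_real c"])
    show "(\<lambda>z. G z - of_real c) holomorphic_on unit_disk"
      unfolding holomorphic_on_open[OF open_ball]
      by (intro ballI exI) (rule DERIV_diff[OF G DERIV_const])
    show "Re (G z - of_real c) = u z" if "z \<in> unit_disk" for z
      using c[OF that] by simp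
  qed
qed

text \<open>
  The Cayley transform \<open>\<phi>\<close> of \<open>G\<close> maps the disc into itself and fixes 0, so Schwarz's lemma gives
  \<open>|\<phi> z| \<le> |z|\<close>. In terms of \<open>G z\<close> this is a disc in the right half-plane, whose rightmost point
  gives the bound.
\<close>
lemma Harnack_inequality_Re_pos:
  assumes G: "G holomorphic_on unit_disk" and pos: "\<And>z. z \<in> unit_disk \<Longrightarrow> 0 < Re (G z)"
    and z: "z \<in> unit_disk"
  shows "Re (G z) * (1 - norm z) \<le> Re (G 0) * (1 + norm z)"
proof -
  define a where "a = G 0"
  define \<phi> where "\<phi> = (\<lambda>z. (G z - a) / (G z + cnj a))"
  have a: "Re a > 0" using pos[of 0] by (simp add: a_def)
  have nz: "G w + cnj a \<noteq> 0" if "w \<in> unit_disk" for w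
  proof -
    have "Re (G w + cnj a) > 0" using a pos[OF that] by simp
    then show ?thesis by (metis less_irrefl zero_complex.sel(1))
  qed
  have sq: "(cmod (G w + cnj a))\<^sup>2 - (cmod (G w - a))\<^sup>2 = 4 * Re a * Re (G w)" for w
    unfolding cmod_power2 by (simp add: power2_eq_square algebra_simps)
  have hol: "\<phi> holomorphic_on ball 0 1"
    unfolding \<phi>_def using nz by (intro holomorphic_intros G) auto
  have lt: "norm (\<phi> w) < 1" if "norm w < 1" for w
  proof -
    have w: "w \<in> unit_disk" using that by simp
    have "(cmod (G w - a))\<^sup>2 < (cmod (G w + cnj a))\<^sup>2"
      using sq[of w] a pos[OF w] by (smt (verit) mult_pos_pos)
    then have "cmod (G w - a) < cmod (G w + cnj a)" by (rule power2_less_imp_less) simp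
    then show ?thesis using nz[OF w] by (simp add: \<phi>_def norm_divide divide_less_eq_1)
  qed
  have "norm (\<phi> z) \<le> norm z"
    using Schwarz_Lemma(1)[OF hol _ lt] z by (simp add: \<phi>_def a_def)
  then have le: "cmod (G z - a) \<le> norm z * cmod (G z + cnj a)"
    using nz[OF z] by (simp add: \<phi>_def norm_divide divide_le_eq)
  define x where "x = Re (G z)"
  define b where "b = Re a"
  define y where "y = Im (G z) - Im a"
  define s where "s = norm z"
  have s: "0 \<le> s" "s < 1" using z by (auto simp: s_def)
  have xb: "x > 0" "b > 0" using a pos[OF z] by (auto simp: x_def b_def)
  have "(cmod (G z - a))\<^sup>2 \<le> (s * cmod (G z + cnj a))\<^sup>2"
    using le by (intro power_mono) (auto simp: s_def)
  then have "(x - b)\<^sup>2 + y\<^sup>2 \<le> s\<^sup>2 * ((x + b)\<^sup>2 + y\<^sup>2)"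
    by (simp add: power_mult_distrib cmod_power2 x_def b_def y_def)
  moreover have "s\<^sup>2 * y\<^sup>2 \<le> y\<^sup>2"
    using s by (intro mult_left_le_one_le) (auto simp: power_le_one)
  ultimately have "(x - b)\<^sup>2 \<le> (s * (x + b))\<^sup>2"
    by (simp add: power_mult_distrib[of s] distrib_left[of "s\<^sup>2"])
  then have "x - b \<le> s * (x + b)" using s xb by (intro power2_le_imp_le[of "x - b"]) auto
  then show ?thesis by (simp add: x_def b_def s_def a_def algebra_simps)
qed

text \<open>
  A nonnegative harmonic function may vanish at 0, where the Cayley transform degenerates; adding a
  small constant makes it strictly positive.
\<close>
lemma Har_plus_Harnack:
  assumes u: "u \<in> Har_plus" and z: "z \<in> unit_disk"
  shows "u z * (1 - norm z) \<le> u 0 * (1 + norm z)"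
proof -
  obtain G where G: "G holomorphic_on unit_disk" "\<And>z. z \<in> unit_disk \<Longrightarrow> Re (G z) = u z"
    using u harmonic_on_disk_eq_Re_holomorphic by (auto simp: Har_plus_def)
  have "(u z + \<epsilon>) * (1 - norm z) \<le> (u 0 + \<epsilon>) * (1 + norm z)" if "\<epsilon> > 0" for \<epsilon>
  proof -
    have "(\<lambda>w. G w + of_real \<epsilon>) holomorphic_on unit_disk"
      using G(1) by (intro holomorphic_intros)
    then show ?thesis
      using Harnack_inequality_Re_pos[of "\<lambda>w. G w + of_real \<epsilon>" z] G(2)[of z] G(2)[of 0] G(2) u z that
      by (auto simp: Har_plus_def add_nonneg_pos)
  qed
  then have "u z * (1 - norm z) \<le> u 0 * (1 + norm z) + \<epsilon>" if "\<epsilon> > 0" for \<epsilon>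
  proof -
    have "(u z + \<epsilon>/2) * (1 - norm z) \<le> (u 0 + \<epsilon>/2) * (1 + norm z)"
      using \<open>\<And>\<epsilon>. \<epsilon> > 0 \<Longrightarrow> (u z + \<epsilon>) * (1 - norm z) \<le> (u 0 + \<epsilon>) * (1 + norm z)\<close>[of "\<epsilon>/2"] that by simp
    then have "u z * (1 - norm z) \<le> u 0 * (1 + norm z) + \<epsilon> * norm z" by (simp add: field_simps)
    also have "\<dots> \<le> u 0 * (1 + norm z) + \<epsilon>" using z that by simp
    finally show ?thesis .
  qed
  then show ?thesis by (rule field_le_epsilon)
qed

section \<open>Herglotz transforms of finite measures on the disc\<close>

text \<open>
  For \<open>|w| = 1\<close> the real part is the Poisson kernel with pole \<open>w\<close>. For \<open>|w| < 1\<close> it is a bounded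
  positive harmonic function of \<open>z\<close> with value 1 at 0 and of size about \<open>1 / (1 - |w|)\<close> near \<open>w\<close>.
\<close>
definition herglotz_kernel :: "complex \<Rightarrow> complex \<Rightarrow> complex" where
  "herglotz_kernel w z = (1 + cnj w * z) / (1 - cnj w * z)"

lemma herglotz_kernel_measurable [measurable]:
  "(\<lambda>w. herglotz_kernel w z) \<in> borel_measurable borel"
proof -
  have [measurable]: "cnj \<in> borel_measurable borel"
    by (intro borel_measurable_continuous_onI continuous_intros)
  show ?thesis unfolding herglotz_kernel_def by measurable
qed

lemma norm_herglotz_kernel_le:
  assumes "cmod w * cmod z \<le> s" "s < 1"
  shows "cmod (herglotz_kernel w z) \<le> 2 / (1 - s)"
proof -
  have q: "cmod (cnj w * z) \<le> s" using assms by (simp add: norm_mult)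
  have "cmod (1 + cnj w * z) \<le> 2"
    using norm_triangle_ineq[of 1 "cnj w * z"] q assms(2) by simp
  moreover have "1 - s \<le> cmod (1 - cnj w * z)"
    using norm_triangle_ineq2[of 1 "cnj w * z"] q by simp
  ultimately show ?thesis
    using assms(2) unfolding herglotz_kernel_def norm_divide by (intro frac_le) auto
qed

lemma Re_herglotz_kernel:
  "Re (herglotz_kernel w z) = (1 - (cmod w * cmod z)\<^sup>2) / (cmod (1 - cnj w * z))\<^sup>2"
proof -
  define q where "q = cnj w * z"
  have "Re ((1 + q) / (1 - q)) = (1 - (cmod q)\<^sup>2) / (cmod (1 - q))\<^sup>2"
    unfolding Re_divide cmod_power2
    by (rule arg_cong2[where f = "(/)"]) (simp_all add: power2_eq_square algebra_simps)
  then show ?thesis by (simp add: herglotz_kernel_def q_def norm_mult)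
qed

lemma Re_herglotz_kernel_nonneg:
  assumes "cmod w \<le> 1" "cmod z \<le> 1"
  shows "0 \<le> Re (herglotz_kernel w z)"
  unfolding Re_herglotz_kernel using assms by (simp add: power_le_one mult_le_one)

locale finite_disk_measure = finite_measure M for M :: "complex measure" +
  assumes sets_eq_borel [measurable_cong]: "sets M = sets borel"
    and AE_unit_disk: "AE w in M. cmod w < 1"
begin

definition herglotz :: "complex \<Rightarrow> complex" where
  "herglotz z = (\<integral>w. herglotz_kernel w z \<partial>M)"

lemma space_eq_UNIV [simp]: "space M = UNIV"
  using sets_eq_imp_space_eq[OF sets_eq_borel] by simp

lemma integrable_herglotz_kernel:
  assumes "z \<in> unit_disk"
  shows "integrable M (\<lambda>w. herglotz_kernel w z)"
proof (rule integrable_const_bound)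
  show "AE w in M. norm (herglotz_kernel w z) \<le> 2 / (1 - cmod z)"
    using AE_unit_disk
    by eventually_elim
      (use assms in \<open>auto intro!: norm_herglotz_kernel_le mult_left_le_one_le\<close>)
qed measurable

lemma Re_herglotz:
  assumes "z \<in> unit_disk"
  shows "Re (herglotz z) = (\<integral>w. Re (herglotz_kernel w z) \<partial>M)"
  unfolding herglotz_def using integrable_herglotz_kernel[OF assms] by simp

lemma herglotz_0: "herglotz 0 = of_real (measure M UNIV)"
  by (simp add: herglotz_def herglotz_kernel_def scaleR_conv_of_real)

lemma Re_herglotz_nonneg:
  assumes "z \<in> unit_disk"
  shows "0 \<le> Re (herglotz z)"
  unfolding Re_herglotz[OF assms] using AE_unit_disk
  by (intro integral_nonneg_AE, eventually_elim) (use assms in \<open>auto intro!: Re_herglotz_kernel_nonneg\<close>)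

text \<open>
  Expanding \<open>1 / (1 - cnj w z)\<close> as a geometric series and integrating termwise writes the transform
  as a power series whose coefficients are the moments of \<open>M\<close>.
\<close>
lemma holomorphic_herglotz: "herglotz holomorphic_on unit_disk"
proof -
  have [measurable]: "cnj \<in> borel_measurable borel"
    by (intro borel_measurable_continuous_onI continuous_intros)
  have sums: "(\<lambda>n. (\<integral>w. cnj w ^ n \<partial>M) * (z - 0) ^ n) sums (\<integral>w. (\<Sum>n. (cnj w * z) ^ n) \<partial>M)"
    if z: "z \<in> ball 0 1" for z
  proof -
    have norm_le: "AE w in M. norm ((cnj w * z) ^ n) \<le> cmod z ^ n" for n
      using AE_unit_disk
      by eventually_elim
        (auto simp: norm_mult norm_power intro!: power_mono mult_left_le_one_le)
    have int: "integrable M (\<lambda>w. (cnj w * z) ^ n)" for n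
      using norm_le by (rule integrable_const_bound) measurable
    have "(\<integral>w. norm ((cnj w * z) ^ n) \<partial>M) \<le> (\<integral>w. cmod z ^ n \<partial>M)" for n
      using norm_le int by (intro integral_mono_AE integrable_norm) auto
    then have int_le: "norm (\<integral>w. norm ((cnj w * z) ^ n) \<partial>M) \<le> measure M UNIV * cmod z ^ n" for n
      by simp
    have "(\<lambda>n. \<integral>w. (cnj w * z) ^ n \<partial>M) sums (\<integral>w. (\<Sum>n. (cnj w * z) ^ n) \<partial>M)"
    proof (rule sums_integral[OF int])
      show "AE w in M. summable (\<lambda>n. norm ((cnj w * z) ^ n))"
        using AE_unit_disk
      proof eventually_elim
        case (elim w)
        have "cmod (cnj w * z) < 1"
          using elim z mult_left_le_one_le[of "cmod z" "cmod w"] by (simp add: norm_mult)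
        then show ?case by (simp add: norm_power)
      qed
      show "summable (\<lambda>n. \<integral>w. norm ((cnj w * z) ^ n) \<partial>M)"
        using z by (intro summable_comparison_test'[OF _ int_le] summable_mult summable_geometric) auto
    qed
    moreover have "(\<integral>w. (cnj w * z) ^ n \<partial>M) = (\<integral>w. cnj w ^ n \<partial>M) * (z - 0) ^ n" for n
      by (simp add: power_mult_distrib)
    ultimately show ?thesis by simp
  qed
  have "(\<lambda>z. 2 * (\<integral>w. (\<Sum>n. (cnj w * z) ^ n) \<partial>M) - of_real (measure M UNIV)) holomorphic_on unit_disk"
    by (intro holomorphic_intros power_series_holomorphic[OF sums])
  moreover have "2 * (\<integral>w. (\<Sum>n. (cnj w * z) ^ n) \<partial>M) - of_real (measure M UNIV) = herglotz z"
    if z: "z \<in> unit_disk" for z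
  proof -
    have "AE w in M. (\<Sum>n. (cnj w * z) ^ n) = (herglotz_kernel w z + 1) / 2"
      using AE_unit_disk
    proof eventually_elim
      case (elim w)
      have lt: "cmod (cnj w * z) < 1"
        using elim z mult_left_le_one_le[of "cmod z" "cmod w"] by (simp add: norm_mult)
      then have "1 - cnj w * z \<noteq> 0" by auto
      then show ?case
        unfolding suminf_geometric[OF lt] herglotz_kernel_def by (simp add: field_simps)
    qed
    then have "(\<integral>w. (\<Sum>n. (cnj w * z) ^ n) \<partial>M) = (\<integral>w. (herglotz_kernel w z + 1) / 2 \<partial>M)"
      by (intro integral_cong_AE) measurable
    also have "\<dots> = (herglotz z + of_real (measure M UNIV)) / 2"
      using integrable_herglotz_kernel[OF z] by (simp add: herglotz_def scaleR_conv_of_real)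
    finally show ?thesis by (simp only:) (simp add: field_simps)
  qed
  ultimately show ?thesis by (rule holomorphic_transform)
qed

text \<open>
  Multiplied by \<open>1 - r\<close>, the kernels are bounded by 2 and tend to 0 for each fixed \<open>w\<close> inside the
  disc, so dominated convergence applies. For \<open>w = \<zeta>\<close> the limit would be 2.
\<close>
lemma herglotz_radial_little_o:
  assumes \<zeta>: "cmod \<zeta> = 1" and r: "\<And>n. 0 \<le> r n" "\<And>n. r n < 1" "r \<longlonglongrightarrow> 1"
  shows "(\<lambda>n. (1 - r n) * Re (herglotz (of_real (r n) * \<zeta>))) \<longlonglongrightarrow> 0"
proof -
  have disk: "of_real (r n) * \<zeta> \<in> unit_disk" for n using \<zeta> r by (simp add: norm_mult)
  have "(\<lambda>n. \<integral>w. (1 - r n) * Re (herglotz_kernel w (of_real (r n) * \<zeta>)) \<partial>M) \<longlonglongrightarrow> (\<integral>w. 0 \<partial>M)"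
  proof (rule integral_dominated_convergence[where w = "\<lambda>_. 2"])
    show "AE w in M. (\<lambda>n. (1 - r n) * Re (herglotz_kernel w (of_real (r n) * \<zeta>))) \<longlonglongrightarrow> 0"
      using AE_unit_disk
    proof eventually_elim
      case (elim w)
      have "cmod (cnj w * \<zeta>) < 1" using elim \<zeta> by (simp add: norm_mult)
      then have "1 - cnj w * (of_real 1 * \<zeta>) \<noteq> 0" by auto
      then have "(\<lambda>n. (1 - r n) * Re (herglotz_kernel w (of_real (r n) * \<zeta>)))
        \<longlonglongrightarrow> (1 - 1) * Re (herglotz_kernel w (of_real 1 * \<zeta>))"
        unfolding herglotz_kernel_def by (intro tendsto_intros r)
      then show ?case by simp
    qed
    show "AE w in M. norm ((1 - r n) * Re (herglotz_kernel w (of_real (r n) * \<zeta>))) \<le> 2" for n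
      using AE_unit_disk
    proof eventually_elim
      case (elim w)
      have "\<bar>Re (herglotz_kernel w (of_real (r n) * \<zeta>))\<bar> \<le> 2 / (1 - r n)"
        using r(1,2)[of n] elim \<zeta>
        by (intro order_trans[OF abs_Re_le_cmod norm_herglotz_kernel_le])
          (auto simp: norm_mult intro!: mult_left_le_one_le)
      then have "(1 - r n) * \<bar>Re (herglotz_kernel w (of_real (r n) * \<zeta>))\<bar> \<le> 2"
        using r(2)[of n] by (simp add: pos_le_divide_eq mult.commute)
      then show ?case using r(2)[of n] by (simp add: abs_mult)
    qed
  qed auto
  then show ?thesis by (simp add: Re_herglotz[OF disk])
qed

lemma herglotz_less_Poisson_radially:
  assumes \<zeta>: "cmod \<zeta> = 1"
  obtains z where "z \<in> unit_disk" "Re (herglotz z) < Re (herglotz_kernel \<zeta> z)"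
proof -
  define r where "r = (\<lambda>n. 1 - inverse (real (Suc n)))"
  have r: "0 \<le> r n" "r n < 1" for n by (auto simp: r_def field_simps)
  have "r \<longlonglongrightarrow> 1 - 0" unfolding r_def by (intro tendsto_diff tendsto_const LIMSEQ_inverse_real_of_nat)
  then have "(\<lambda>n. (1 - r n) * Re (herglotz (of_real (r n) * \<zeta>))) \<longlonglongrightarrow> 0"
    using herglotz_radial_little_o[OF \<zeta> r] by simp
  then have "\<forall>\<^sub>F n in sequentially. (1 - r n) * Re (herglotz (of_real (r n) * \<zeta>)) < 1"
    by (rule order_tendstoD) simp
  then obtain n where n: "(1 - r n) * Re (herglotz (of_real (r n) * \<zeta>)) < 1"
    using eventually_happens'[OF sequentially_bot] by blast
  define z where "z = of_real (r n) * \<zeta>"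
  have "cnj \<zeta> * z = of_real (r n)"
    using \<zeta> complex_norm_square[of \<zeta>] by (simp add: z_def mult.commute)
  then have "herglotz_kernel \<zeta> z = of_real ((1 + r n) / (1 - r n))"
    by (simp add: herglotz_kernel_def)
  then have "Re (herglotz_kernel \<zeta> z) = (1 + r n) / (1 - r n)" by simp
  moreover have "Re (herglotz z) < (1 + r n) / (1 - r n)"
    using n r[of n] by (simp add: z_def pos_less_divide_eq mult.commute)
  moreover have "z \<in> unit_disk" using r[of n] \<zeta> by (simp add: z_def norm_mult)
  ultimately show ?thesis using that by simp
qed

lemma herglotz_ge_of_kernel_ge:
  assumes z: "z \<in> unit_disk" and A: "A \<in> sets borel"
    and k: "\<And>w. w \<in> A \<Longrightarrow> k \<le> Re (herglotz_kernel w z)"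
  shows "k * measure M A \<le> Re (herglotz z)"
proof -
  have "k * measure M A = (\<integral>w. indicator A w * k \<partial>M)"
    using A by (simp add: sets_eq_borel emeasure_finite)
  also have "\<dots> \<le> (\<integral>w. Re (herglotz_kernel w z) \<partial>M)"
  proof (rule integral_mono_AE)
    show "integrable M (\<lambda>w. indicator A w * k)"
      using A by (intro integrable_mult_left integrable_real_indicator)
        (auto simp: sets_eq_borel emeasure_eq_measure)
    show "AE w in M. indicator A w * k \<le> Re (herglotz_kernel w z)"
      using AE_unit_disk
      by eventually_elim (use z k in \<open>auto simp: indicator_def intro!: Re_herglotz_kernel_nonneg\<close>)
  qed (use integrable_herglotz_kernel[OF z] in simp)
  finally show ?thesis by (simp add: Re_herglotz[OF z])
qed

end

lemma finite_disk_measureI: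
  assumes "sets M = sets borel" "emeasure M UNIV \<noteq> \<infinity>" "AE w in M. cmod w < 1"
  shows "finite_disk_measure M"
proof -
  interpret finite_measure M
    using assms(2) sets_eq_imp_space_eq[OF assms(1)] by (intro finite_measureI) simp
  show ?thesis using assms by unfold_locales
qed

section \<open>Circular means and the Nevanlinna class\<close>

lemma holomorphic_herglotz_kernel:
  assumes "cmod w \<le> 1"
  shows "herglotz_kernel w holomorphic_on unit_disk"
proof -
  have "1 - cnj w * z \<noteq> 0" if "z \<in> unit_disk" for z
  proof -
    have "cmod (cnj w * z) < 1"
      using assms that mult_left_le_one_le[of "cmod z" "cmod w"] by (simp add: norm_mult)
    then show ?thesis by auto
  qed
  then show ?thesis unfolding herglotz_kernel_def[abs_def] by (intro holomorphic_intros)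
qed

lemma circle_in_unit_disk: "0 \<le> r \<Longrightarrow> r < 1 \<Longrightarrow> of_real r * cis \<theta> \<in> unit_disk"
  by (simp add: norm_mult)

lemma continuous_on_circle:
  assumes "G holomorphic_on unit_disk" "0 \<le> r" "r < 1"
  shows "continuous_on A (\<lambda>\<theta>. G (of_real r * cis \<theta>))"
  by (rule continuous_on_compose2[OF holomorphic_on_imp_continuous_on[OF assms(1)]])
    (use circle_in_unit_disk[OF assms(2,3)] in \<open>auto intro!: continuous_intros\<close>)

lemma has_integral_Re_circle:
  assumes G: "G holomorphic_on unit_disk" and r: "0 \<le> r" "r < 1"
  shows "((\<lambda>\<theta>. Re (G (of_real r * cis \<theta>))) has_integral 2 * pi * Re (G 0)) {0..2 * pi}"
proof (cases "r = 0")
  case True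
  then show ?thesis using has_integral_const_real[of "Re (G 0)" 0 "2 * pi"] by simp
next
  case False
  then have r0: "r > 0" using r by simp
  \<comment> \<open>Cauchy's formula at 0, parametrised by the angle.\<close>
  have "((\<lambda>u. G u / (u - 0)) has_contour_integral 2 * of_real pi * \<i> * G 0) (circlepath 0 r)"
    using r r0 by (intro Cauchy_integral_circlepath_simple holomorphic_on_subset[OF G]) auto
  then have "((\<lambda>t. G (of_real r * cis t) / (of_real r * cis t) * r * \<i> * cis t)
      has_integral 2 * of_real pi * \<i> * G 0) {0..2 * pi}"
    unfolding circlepath_def by (simp add: has_contour_integral_part_circlepath_iff)
  moreover have "(\<lambda>t. G (of_real r * cis t) / (of_real r * cis t) * r * \<i> * cis t)
      = (\<lambda>t. \<i> * G (of_real r * cis t))"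
    using r0 by (auto simp: fun_eq_iff)
  ultimately have "((\<lambda>t. \<i> * G (of_real r * cis t)) has_integral 2 * of_real pi * \<i> * G 0) {0..2 * pi}"
    by simp
  from has_integral_Im[OF this] show ?thesis by simp
qed

lemma negligible_cis_eq: "negligible {\<theta>. cis \<theta> = \<zeta>}"
proof (cases "\<exists>t. cis t = \<zeta>")
  case True
  then obtain t where t: "cis t = \<zeta>" by blast
  have "{\<theta>. cis \<theta> = \<zeta>} \<subseteq> range (\<lambda>n::int. t + 2 * pi * of_int n)"
    using sin_cos_eq_iff[of _ t] by (auto simp: complex_eq_iff simp flip: t)
  then have "countable {\<theta>. cis \<theta> = \<zeta>}" by (rule countable_subset) simp
  then show ?thesis
    unfolding negligible_iff_null_sets by (intro null_sets_completionI countable_imp_null_set_lborel)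
qed auto

text \<open>
  Truncation at \<open>B\<close> supplies the dominating function, and the Poisson kernel tends to 0 at every
  boundary point except its pole.
\<close>
lemma circle_integral_min_Poisson_tendsto_0:
  assumes \<zeta>: "cmod \<zeta> = 1" and B: "0 \<le> B"
  shows "((\<lambda>r. integral {0..2 * pi} (\<lambda>\<theta>. min (Re (herglotz_kernel \<zeta> (of_real r * cis \<theta>))) B))
    \<longlongrightarrow> 0) (at_left 1)"
proof (rule tendsto_at_left_sequentially[of 0])
  fix r :: "nat \<Rightarrow> real"
  assume r: "\<And>n. r n < 1" "\<And>n. 0 < r n" "r \<longlonglongrightarrow> 1"
  define f where "f = (\<lambda>n \<theta>. min (Re (herglotz_kernel \<zeta> (of_real (r n) * cis \<theta>))) B)"
  \<comment> \<open>The integrands are altered on the null set where they do not tend to 0.\<close>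
  define g where "g = (\<lambda>n \<theta>. if cis \<theta> = \<zeta> then 0 else f n \<theta>)"
  have r0: "0 \<le> r n" for n using r(2)[of n] by simp
  have f_int: "f n integrable_on {0..2 * pi}" for n
    unfolding f_def
    by (intro integrable_continuous_real continuous_intros
        continuous_on_circle[OF holomorphic_herglotz_kernel] r r0) (use \<zeta> in auto)
  have fg: "\<theta> \<in> {0..2 * pi} - {\<theta>. cis \<theta> = \<zeta>} \<Longrightarrow> g n \<theta> = f n \<theta>" for n \<theta>
    by (simp add: g_def)
  have f_nonneg: "0 \<le> f n \<theta>" for n \<theta>
    unfolding f_def using B \<zeta> r(1) r0 by (simp add: Re_herglotz_kernel_nonneg norm_mult less_imp_le)
  have "(\<lambda>n. integral {0..2 * pi} (g n)) \<longlonglongrightarrow> integral {0..2 * pi} (\<lambda>_. 0)"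
  proof (rule dominated_convergence[where h = "\<lambda>_. B"])
    show "g n integrable_on {0..2 * pi}" for n
      by (rule integrable_spike[OF f_int negligible_cis_eq fg])
    show "norm (g n \<theta>) \<le> B" if "\<theta> \<in> {0..2 * pi}" for n \<theta>
      using f_nonneg[of n \<theta>] B by (simp add: g_def) (simp add: f_def)
    show "(\<lambda>n. g n \<theta>) \<longlonglongrightarrow> 0" if "\<theta> \<in> {0..2 * pi}" for \<theta>
    proof (cases "cis \<theta> = \<zeta>")
      case False
      have "cnj \<zeta> * cis \<theta> \<noteq> 1"
      proof
        assume "cnj \<zeta> * cis \<theta> = 1"
        then have "\<zeta> * cnj \<zeta> * cis \<theta> = \<zeta>" by (simp only: mult.assoc mult_1_right)
        moreover have "\<zeta> * cnj \<zeta> = 1" using complex_norm_square[of \<zeta>] \<zeta> by simp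
        ultimately show False using False by simp
      qed
      then have "(\<lambda>n. Re (herglotz_kernel \<zeta> (of_real (r n) * cis \<theta>)))
          \<longlonglongrightarrow> Re (herglotz_kernel \<zeta> (of_real 1 * cis \<theta>))"
        unfolding herglotz_kernel_def by (intro tendsto_intros r) auto
      moreover have "Re (herglotz_kernel \<zeta> (of_real 1 * cis \<theta>)) = 0"
        unfolding Re_herglotz_kernel using \<zeta> by simp
      ultimately have "(\<lambda>n. f n \<theta>) \<longlonglongrightarrow> min 0 B"
        unfolding f_def by (intro tendsto_min tendsto_const) simp
      then show ?thesis using B False by (simp add: g_def)
    qed (simp add: g_def)
  qed auto
  moreover have "integral {0..2 * pi} (g n) = integral {0..2 * pi} (f n)" for n
    by (rule integral_spike[OF negligible_cis_eq[of \<zeta>]]) (simp add: g_def)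
  ultimately show "(\<lambda>n. integral {0..2 * pi} (\<lambda>\<theta>. min (Re (herglotz_kernel \<zeta> (of_real (r n) * cis \<theta>))) B)) \<longlonglongrightarrow> 0"
    by (simp add: f_def)
qed simp

context finite_disk_measure
begin

text \<open>
  The part of \<open>M\<close> on a smaller disc \<open>|w| \<le> s\<close> has a bounded transform. The part outside has small
  mass for \<open>s\<close> near 1, since \<open>M\<close> has no mass on the circle, and \<open>G\<close> is its transform.
\<close>
lemma herglotz_le_bounded_plus_small:
  assumes "\<epsilon> > 0"
  obtains B G where "0 \<le> B" "G holomorphic_on unit_disk" "Re (G 0) < \<epsilon>"
    "\<And>z. z \<in> unit_disk \<Longrightarrow> 0 \<le> Re (G z)"
    "\<And>z. z \<in> unit_disk \<Longrightarrow> Re (herglotz z) \<le> B + Re (G z)"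
proof -
  define s where "s = (\<lambda>n. 1 - inverse (real (Suc n)))"
  define A where "A = (\<lambda>n. {w. s n < cmod w})"
  have s_mono: "s m \<le> s n" if "m \<le> n" for m n
    using that by (auto simp: s_def field_simps)
  have s_lim: "s \<longlonglongrightarrow> 1 - 0"
    unfolding s_def by (intro tendsto_diff tendsto_const LIMSEQ_inverse_real_of_nat)
  have A_sets: "A n \<in> sets borel" for n
    unfolding A_def by (intro borel_open open_Collect_less continuous_intros)
  have "(\<lambda>n. measure M (A n)) \<longlonglongrightarrow> measure M (\<Inter>n. A n)"
  proof (rule finite_Lim_measure_decseq)
    show "range A \<subseteq> sets M" using A_sets by (auto simp: sets_eq_borel)
    show "decseq A" unfolding decseq_def A_def using s_mono by fastforce
  qed
  moreover have "measure M (\<Inter>n. A n) = 0"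
  proof -
    have "AE w in M. w \<notin> (\<Inter>n. A n)"
      using AE_unit_disk
    proof eventually_elim
      case (elim w)
      have "\<forall>\<^sub>F n in sequentially. cmod w < s n"
        using s_lim elim by (intro order_tendstoD) auto
      then obtain n where "cmod w < s n" using eventually_happens'[OF sequentially_bot] by blast
      then show ?case by (auto simp: A_def intro!: exI[of _ n])
    qed
    then have "emeasure M (\<Inter>n. A n) = 0"
      using A_sets by (intro AE_iff_measurable[THEN iffD1, rotated 2]) (auto simp: sets_eq_borel)
    then show ?thesis by (simp add: measure_def)
  qed
  ultimately have "(\<lambda>n. measure M (A n)) \<longlonglongrightarrow> 0" by simp
  then have "\<forall>\<^sub>F n in sequentially. measure M (A n) < \<epsilon>"
    using assms by (rule order_tendstoD)
  then obtain n where n: "measure M (A n) < \<epsilon>"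
    using eventually_happens'[OF sequentially_bot] by blast
  have An: "A n \<in> sets M" using A_sets by (simp add: sets_eq_borel)
  define M2 where "M2 = density M (\<lambda>w. ennreal (indicator (A n) w))"
  have emeasure_M2: "emeasure M2 UNIV = emeasure M (A n)"
    using An by (simp add: M2_def emeasure_density ennreal_indicator)
  interpret M2: finite_disk_measure M2
  proof (rule finite_disk_measureI)
    show "emeasure M2 UNIV \<noteq> \<infinity>"
      using emeasure_M2 by simp
    show "sets M2 = sets borel" by (simp add: M2_def sets_eq_borel)
    show "AE w in M2. cmod w < 1"
      unfolding M2_def using An AE_unit_disk by (subst AE_density) auto
  qed
  have s1: "s n < 1" by (simp add: s_def)
  show ?thesis
  proof (rule that)
    show "0 \<le> 2 / (1 - s n) * measure M UNIV" using s1 by simp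
    show "M2.herglotz holomorphic_on unit_disk" by (rule M2.holomorphic_herglotz)
    show "Re (M2.herglotz 0) < \<epsilon>"
      using n emeasure_M2 by (simp add: M2.herglotz_0 measure_def)
    fix z assume z: "z \<in> unit_disk"
    show "0 \<le> Re (M2.herglotz z)" by (rule M2.Re_herglotz_nonneg[OF z])
    have int: "integrable M (\<lambda>w. Re (herglotz_kernel w z))"
      using integrable_herglotz_kernel[OF z] by simp
    have int_tail: "integrable M (\<lambda>w. indicator (A n) w * Re (herglotz_kernel w z))"
      using integrable_mult_indicator[OF An int] by simp
    have "Re (herglotz z) \<le> (\<integral>w. 2 / (1 - s n) + indicator (A n) w * Re (herglotz_kernel w z) \<partial>M)"
      unfolding Re_herglotz[OF z]
    proof (rule integral_mono_AE[OF int])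
      show "integrable M (\<lambda>w. 2 / (1 - s n) + indicator (A n) w * Re (herglotz_kernel w z))"
        using int_tail by simp
      show "AE w in M. Re (herglotz_kernel w z)
          \<le> 2 / (1 - s n) + indicator (A n) w * Re (herglotz_kernel w z)"
      proof (rule AE_I2)
        fix w
        show "Re (herglotz_kernel w z) \<le> 2 / (1 - s n) + indicator (A n) w * Re (herglotz_kernel w z)"
        proof (cases "w \<in> A n")
          case False
          then have "cmod w * cmod z \<le> s n"
            using z mult_right_le_one_le[of "cmod w" "cmod z"] by (simp add: A_def)
          then have "Re (herglotz_kernel w z) \<le> 2 / (1 - s n)"
            using s1 by (intro order_trans[OF complex_Re_le_cmod norm_herglotz_kernel_le])
          then show ?thesis using False by simp
        qed (use s1 in simp)
      qed
    qed
    also have "\<dots> = 2 / (1 - s n) * measure M UNIV + (\<integral>w. indicator (A n) w * Re (herglotz_kernel w z) \<partial>M)"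
      using int_tail by simp
    also have "(\<integral>w. indicator (A n) w * Re (herglotz_kernel w z) \<partial>M) = Re (M2.herglotz z)"
      unfolding M2.Re_herglotz[OF z] unfolding M2_def using An by (subst integral_density) auto
    finally show "Re (herglotz z) \<le> 2 / (1 - s n) * measure M UNIV + Re (M2.herglotz z)" .
  qed
qed

text \<open>
  With \<open>B\<close> and \<open>G\<close> from \<open>herglotz_le_bounded_plus_small\<close>, \<open>min P h \<le> min P B + Re G\<close>, and
  the mean of \<open>Re G\<close> over any circle is its value at 0.
\<close>
lemma circle_integral_min_tendsto_0:
  assumes \<zeta>: "cmod \<zeta> = 1"
  shows "((\<lambda>r. integral {0..2 * pi} (\<lambda>\<theta>. min (Re (herglotz_kernel \<zeta> (of_real r * cis \<theta>)))
    (Re (herglotz (of_real r * cis \<theta>))))) \<longlongrightarrow> 0) (at_left 1)"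
    (is "(?I \<longlongrightarrow> 0) _")
proof (rule tendstoI)
  fix \<epsilon> :: real assume \<epsilon>: "\<epsilon> > 0"
  obtain B G where B: "0 \<le> B" and G: "G holomorphic_on unit_disk" "Re (G 0) < \<epsilon> / (4 * pi)"
    "\<And>z. z \<in> unit_disk \<Longrightarrow> 0 \<le> Re (G z)"
    "\<And>z. z \<in> unit_disk \<Longrightarrow> Re (herglotz z) \<le> B + Re (G z)"
    using herglotz_le_bounded_plus_small[of "\<epsilon> / (4 * pi)"] \<epsilon> by auto
  let ?J = "\<lambda>r. integral {0..2 * pi} (\<lambda>\<theta>. min (Re (herglotz_kernel \<zeta> (of_real r * cis \<theta>))) B)"
  have "\<forall>\<^sub>F r in at_left 1. ?J r < \<epsilon> / 2"
    using circle_integral_min_Poisson_tendsto_0[OF \<zeta> B] \<epsilon> by (intro order_tendstoD) auto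
  moreover have "\<forall>\<^sub>F r in at_left 1. r \<in> {0<..<(1::real)}"
    by (rule eventually_at_left_real) simp
  ultimately show "\<forall>\<^sub>F r in at_left 1. dist (?I r) 0 < \<epsilon>"
  proof eventually_elim
    case (elim r)
    then have r: "0 \<le> r" "r < 1" by auto
    note disk = circle_in_unit_disk[OF r]
    note cont = continuous_on_circle[OF holomorphic_herglotz_kernel r]
      continuous_on_circle[OF holomorphic_herglotz r] continuous_on_circle[OF G(1) r]
    have "?I r \<le> integral {0..2 * pi} (\<lambda>\<theta>. min (Re (herglotz_kernel \<zeta> (of_real r * cis \<theta>))) B
        + Re (G (of_real r * cis \<theta>)))"
    proof (intro integral_le integrable_continuous_real continuous_intros cont)
      fix \<theta>
      show "min (Re (herglotz_kernel \<zeta> (of_real r * cis \<theta>))) (Re (herglotz (of_real r * cis \<theta>)))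
        \<le> min (Re (herglotz_kernel \<zeta> (of_real r * cis \<theta>))) B + Re (G (of_real r * cis \<theta>))"
        using G(3,4)[OF disk[of \<theta>]] by linarith
    qed (use \<zeta> in auto)
    also have "\<dots> = ?J r + 2 * pi * Re (G 0)"
      using has_integral_Re_circle[OF G(1) r] \<zeta>
      by (subst integral_add) (auto intro!: integrable_continuous_real continuous_intros cont
          simp: integral_unique)
    also have "2 * pi * Re (G 0) < \<epsilon> / 2" using G(2) by (simp add: field_simps)
    finally have "?I r < \<epsilon>" using elim by simp
    moreover have "0 \<le> ?I r"
      using \<zeta> Re_herglotz_nonneg[OF disk] disk
      by (intro integral_nonneg integrable_continuous_real continuous_intros cont)
        (auto intro!: Re_herglotz_kernel_nonneg simp: norm_mult)
    ultimately show ?case by simp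
  qed
qed

text \<open>
  Since \<open>log_plus |f| = c (P - min P h)\<close> and \<open>P\<close> has mean 1, the circular means converge to \<open>c\<close>.
\<close>
lemma exp_Poisson_minus_herglotz_Nevanlinna:
  assumes \<zeta>: "cmod \<zeta> = 1" and c: "0 \<le> c"
  shows "(\<lambda>z. exp (of_real c * (herglotz_kernel \<zeta> z - herglotz z))) \<in> Nevanlinna"
proof -
  let ?f = "\<lambda>z. exp (of_real c * (herglotz_kernel \<zeta> z - herglotz z))"
  let ?P = "\<lambda>z. Re (herglotz_kernel \<zeta> z)"
  let ?h = "\<lambda>z. Re (herglotz z)"
  let ?I = "\<lambda>r. integral {0..2 * pi} (\<lambda>\<theta>. min (?P (of_real r * cis \<theta>)) (?h (of_real r * cis \<theta>)))"
  have hol: "herglotz_kernel \<zeta> holomorphic_on unit_disk"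
    using \<zeta> by (intro holomorphic_herglotz_kernel) simp
  have log_eq: "log_plus (cmod (?f z)) = c * (?P z - min (?P z) (?h z))" for z
  proof -
    have "log_plus (cmod (?f z)) = max 0 (c * (?P z - ?h z))"
      by (simp add: log_plus_def)
    also have "\<dots> = c * max 0 (?P z - ?h z)"
      using c by (simp add: max_mult_distrib_left)
    also have "max 0 (?P z - ?h z) = ?P z - min (?P z) (?h z)" by simp
    finally show ?thesis .
  qed
  have mean: "1 / (2 * pi) * integral {0..2 * pi} (\<lambda>\<theta>. log_plus (cmod (?f (of_real r * cis \<theta>))))
      = c * (1 - 1 / (2 * pi) * ?I r)" if r: "0 \<le> r" "r < 1" for r
  proof -
    note cont = continuous_on_circle[OF hol r] continuous_on_circle[OF holomorphic_herglotz r]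
    have "integral {0..2 * pi} (\<lambda>\<theta>. log_plus (cmod (?f (of_real r * cis \<theta>))))
       = c * (integral {0..2 * pi} (\<lambda>\<theta>. ?P (of_real r * cis \<theta>)) - ?I r)"
      unfolding log_eq integral_mult_right
      by (subst Henstock_Kurzweil_Integration.integral_diff)
        (auto intro!: integrable_continuous_real continuous_intros cont)
    also have "integral {0..2 * pi} (\<lambda>\<theta>. ?P (of_real r * cis \<theta>)) = 2 * pi"
      using has_integral_Re_circle[OF hol r] by (simp add: integral_unique herglotz_kernel_def)
    finally show ?thesis by (simp add: field_simps)
  qed
  have "((\<lambda>r. c * (1 - 1 / (2 * pi) * ?I r)) \<longlongrightarrow> c * (1 - 1 / (2 * pi) * 0)) (at_left 1)"
    by (intro tendsto_intros circle_integral_min_tendsto_0 \<zeta>)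
  moreover have "\<forall>\<^sub>F r in at_left 1. c * (1 - 1 / (2 * pi) * ?I r) =
      1 / (2 * pi) * integral {0..2 * pi} (\<lambda>\<theta>. log_plus (cmod (?f (of_real r * cis \<theta>))))"
    using eventually_at_left_real[of 0 "1::real", OF zero_less_one]
    by eventually_elim (use mean in auto)
  ultimately have "((\<lambda>r. 1 / (2 * pi) * integral {0..2 * pi} (\<lambda>\<theta>. log_plus (cmod (?f (of_real r * cis \<theta>)))))
      \<longlongrightarrow> c * (1 - 1 / (2 * pi) * 0)) (at_left 1)"
    by (rule Lim_transform_eventually)
  moreover have "?f holomorphic_on unit_disk"
    by (intro holomorphic_intros hol holomorphic_herglotz)
  ultimately show ?thesis unfolding Nevanlinna_def by blast
qed

end

section \<open>Domination of the Poisson kernel, and sampling\<close>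

lemma Re_herglotz_kernel_unit:
  assumes "cmod \<zeta> = 1"
  shows "Re (herglotz_kernel \<zeta> z) = (1 - (cmod z)\<^sup>2) / (cmod (\<zeta> - z))\<^sup>2"
proof -
  have "\<zeta> * (1 - cnj \<zeta> * z) = \<zeta> - z"
    using complex_norm_square[of \<zeta>] assms by (simp add: right_diff_distrib flip: mult.assoc)
  then have "cmod (\<zeta> - z) = cmod (1 - cnj \<zeta> * z)"
    using assms by (metis mult_1 norm_mult)
  then show ?thesis using assms by (simp add: Re_herglotz_kernel)
qed

lemma ball_subset_pseudohyp_ball:
  assumes a: "a \<in> unit_disk" and \<delta>: "\<delta> \<le> 1"
  shows "ball a (\<delta> * (1 - cmod a)) \<subseteq> pseudohyp_ball a \<delta>"
proof
  fix w assume w: "w \<in> ball a (\<delta> * (1 - cmod a))"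
  then have d: "cmod (a - w) < \<delta> * (1 - cmod a)" by (simp add: dist_norm)
  have "\<delta> * (1 - cmod a) \<le> 1 * (1 - cmod a)" using a \<delta> by (intro mult_right_mono) auto
  then have w1: "cmod w < 1" using d norm_triangle_ineq2[of w a] by (simp add: norm_minus_commute)
  have "1 - cmod a \<le> 1 - cmod a * cmod w"
    using w1 mult_left_le[of "cmod w" "cmod a"] by simp
  also have "\<dots> \<le> cmod (1 - a * cnj w)"
    using norm_triangle_ineq2[of 1 "a * cnj w"] by (simp add: norm_mult)
  finally have den: "1 - cmod a \<le> cmod (1 - a * cnj w)" .
  have "0 < \<delta> * (1 - cmod a)" using d norm_ge_zero[of "a - w"] by linarith
  then have "0 < \<delta>" using a by (simp add: zero_less_mult_iff)
  then have "cmod (a - w) < \<delta> * cmod (1 - a * cnj w)"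
    using d den by (meson less_le_trans mult_left_mono less_imp_le)
  moreover have "0 < cmod (1 - a * cnj w)" using den a by auto
  ultimately have "pseudohyp_dist a w < \<delta>"
    by (simp add: pseudohyp_dist_def norm_divide divide_less_eq)
  then show "w \<in> pseudohyp_ball a \<delta>" using w1 by (simp add: pseudohyp_ball_def)
qed

text \<open>
  For \<open>w = a\<close> the real part is \<open>(1 + |a|^2) / (1 - |a|^2)\<close>. Moving \<open>w\<close> by half the distance from
  \<open>a\<close> to the circle keeps the order of magnitude \<open>1 / (1 - |a|)\<close>.
\<close>
lemma Re_herglotz_kernel_ge_near_diagonal:
  assumes a: "a \<in> unit_disk" and w: "w \<in> ball a ((1 - cmod a) / 2)"
  shows "4 / (25 * (1 - cmod a)) \<le> Re (herglotz_kernel w a)"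
proof -
  define t where "t = 1 - cmod a"
  have t: "0 < t" "t \<le> 1" using a by (auto simp: t_def)
  have d: "cmod (a - w) < t / 2" using w by (simp add: dist_norm t_def)
  have w1: "cmod w \<le> 1" using d norm_triangle_ineq2[of w a] t by (simp add: norm_minus_commute t_def)
  have a2: "1 - (cmod a)\<^sup>2 = t * (2 - t)" by (simp add: t_def power2_eq_square algebra_simps)
  have tt: "t \<le> t * (2 - t)" "t * (2 - t) \<le> 2 * t" using t by (auto simp: field_simps mult_left_le)
  \<comment> \<open>Comparison with the value at \<open>w = a\<close>, where the denominator is \<open>1 - |a|^2 \<le> 2 t\<close>.\<close>
  have "1 - cnj w * a = of_real (1 - (cmod a)\<^sup>2) + cnj (a - w) * a"
    using complex_norm_square[of a] by (simp add: algebra_simps)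
  then have "cmod (1 - cnj w * a) \<le> cmod (of_real (1 - (cmod a)\<^sup>2)) + cmod (cnj (a - w) * a)"
    by (metis norm_triangle_ineq)
  also have "cmod (of_real (1 - (cmod a)\<^sup>2)) = t * (2 - t)" using a2 t by (simp only: norm_of_real) simp
  also have "cmod (cnj (a - w) * a) = cmod (a - w) * cmod a" by (simp only: norm_mult complex_mod_cnj)
  also have "cmod (a - w) * cmod a \<le> t / 2"
    using d a by (meson less_imp_le mem_ball_0 mult_right_le_one_le norm_ge_zero order_trans)
  finally have up: "cmod (1 - cnj w * a) \<le> 5 / 2 * t" using tt by simp
  have "cmod w * cmod a \<le> cmod a" using w1 by (simp add: mult_left_le_one_le)
  then have "(cmod w * cmod a)\<^sup>2 \<le> (cmod a)\<^sup>2" by (intro power_mono) auto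
  then have num: "t \<le> 1 - (cmod w * cmod a)\<^sup>2" using a2 tt by linarith
  have "cmod (cnj w * a) < 1"
    using \<open>cmod w * cmod a \<le> cmod a\<close> a by (simp add: norm_mult)
  then have "1 - cnj w * a \<noteq> 0" by auto
  then have pos: "0 < (cmod (1 - cnj w * a))\<^sup>2" by simp
  have "4 / (25 * t) = t / (5 / 2 * t)\<^sup>2" using t by (simp add: field_simps power2_eq_square)
  also have "\<dots> \<le> (1 - (cmod w * cmod a)\<^sup>2) / (cmod (1 - cnj w * a))\<^sup>2"
    using num up pos t by (intro frac_le power_mono) auto
  finally show ?thesis by (simp add: Re_herglotz_kernel t_def)
qed

text \<open>
  Write \<open>t = 1 - |a|\<close> and \<open>D = |\<zeta> - a|\<close>. On the disc of radius \<open>t / 2\<close> around \<open>a\<close> the density of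
  \<open>M\<close> is comparable to \<open>1 / D^2\<close>, so the disc has mass of order \<open>t^2 / D^2\<close>; the kernel there is of
  order \<open>1 / t\<close>. Their product has the order \<open>t / D^2\<close> of the Poisson kernel at \<open>a\<close>, and the factor
  40 in the density absorbs the constants.
\<close>
lemma Poisson_dominated_by_herglotz:
  assumes \<Lambda>: "\<Lambda> \<subseteq> unit_disk" and \<zeta>: "\<zeta> \<in> unit_circle"
    and fin: "Hayman_Lyons_integral \<Lambda> \<zeta> (1/2) < \<infinity>"
  obtains M where "finite_disk_measure M"
    "\<And>a. a \<in> \<Lambda> \<Longrightarrow> Re (herglotz_kernel \<zeta> a) \<le> Re (finite_disk_measure.herglotz M a)"
proof -
  have \<zeta>1: "cmod \<zeta> = 1" using \<zeta> by simp
  define r where "r = (\<lambda>a. (1 - cmod a) / 2)"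
  define U where "U = (\<Union>a\<in>\<Lambda>. ball a (r a))"
  have U_nbhd: "U \<subseteq> pseudohyp_nbhd \<Lambda> (1/2)"
    using ball_subset_pseudohyp_ball[of _ "1/2"] \<Lambda>
    unfolding U_def r_def pseudohyp_nbhd_def by (fastforce simp: subset_iff)
  then have U_disk: "U \<subseteq> unit_disk"
    by (auto simp: pseudohyp_nbhd_def pseudohyp_ball_def)
  have [measurable]: "U \<in> sets borel" unfolding U_def by (intro borel_open open_UN) auto
  define g where "g = (\<lambda>w. ennreal (40 / (cmod (\<zeta> - w))\<^sup>2) * indicator U w)"
  have [measurable]: "g \<in> borel_measurable borel" unfolding g_def by measurable
  define M where "M = density lborel g"
  have emeasure_M: "emeasure M A = (\<integral>\<^sup>+w. g w * indicator A w \<partial>lborel)" if "A \<in> sets borel" for A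
    using that by (simp add: M_def emeasure_density)
  have g_eq: "g w = ennreal 40 * (ennreal (1 / (cmod (\<zeta> - w))\<^sup>2) * indicator U w)" for w
    unfolding g_def by (subst mult.assoc[symmetric], subst ennreal_mult[symmetric]) auto
  have "emeasure M UNIV = (\<integral>\<^sup>+w. g w \<partial>lborel)"
    using emeasure_M[of UNIV] by simp
  also have "\<dots> = ennreal 40 * (\<integral>\<^sup>+w\<in>U. ennreal (1 / (cmod (\<zeta> - w))\<^sup>2) \<partial>lborel)"
    unfolding g_eq by (rule nn_integral_cmult) measurable
  also have "\<dots> \<le> ennreal 40 * Hayman_Lyons_integral \<Lambda> \<zeta> (1/2)"
    unfolding Hayman_Lyons_integral_def using U_nbhd
    by (intro mult_left_mono nn_integral_mono) (auto simp: indicator_def)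
  also have "\<dots> < \<infinity>" using fin by (simp add: ennreal_mult_less_top)
  finally have finM: "emeasure M UNIV < \<infinity>" .
  have "AE w in M. cmod w < 1"
    unfolding M_def using U_disk by (subst AE_density) (auto simp: g_def indicator_def intro!: AE_I2)
  then interpret finite_disk_measure M
    using finM by (intro finite_disk_measureI) (auto simp: M_def)
  show ?thesis
  proof (rule that)
    show "finite_disk_measure M" by unfold_locales
    fix a assume a: "a \<in> \<Lambda>"
    then have disk: "a \<in> unit_disk" using \<Lambda> by blast
    define t where "t = 1 - cmod a"
    have t: "0 < t" using disk by (simp add: t_def)
    define D where "D = cmod (\<zeta> - a)"
    have tD: "t \<le> D" using norm_triangle_ineq2[of \<zeta> a] \<zeta>1 by (simp add: t_def D_def)
    have ball_U: "ball a (r a) \<subseteq> U" using a by (auto simp: U_def)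
    \<comment> \<open>On the disc, \<open>|\<zeta> - w| \<le> D + t / 2 \<le> 3 D / 2\<close>, and \<open>40 / (3 / 2)^2 = 160 / 9\<close>.\<close>
    have "160 / 9 / D\<^sup>2 * (pi * (t / 2)\<^sup>2) \<le> measure M (ball a (r a))"
    proof -
      have "ennreal (160 / 9 / D\<^sup>2) * indicator (ball a (r a)) w \<le> g w * indicator (ball a (r a)) w" for w
      proof (cases "w \<in> ball a (r a)")
        case True
        have aw: "cmod (a - w) < t / 2" using True by (simp add: dist_norm r_def t_def)
        have "cmod (\<zeta> - w) \<le> D + cmod (a - w)"
          using norm_triangle_ineq[of "\<zeta> - a" "a - w"] by (simp add: D_def)
        then have up: "cmod (\<zeta> - w) \<le> 3 / 2 * D" using aw tD by simp
        have "w \<in> unit_disk" using True ball_U U_disk by blast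
        then have "w \<noteq> \<zeta>" using \<zeta>1 by auto
        then have "40 / (3 / 2 * D)\<^sup>2 \<le> 40 / (cmod (\<zeta> - w))\<^sup>2"
          using up by (intro frac_le power_mono) auto
        then have "160 / 9 / D\<^sup>2 \<le> 40 / (cmod (\<zeta> - w))\<^sup>2"
          by (simp add: power2_eq_square)
        then show ?thesis using True ball_U by (auto simp: g_def indicator_def intro: ennreal_leI)
      qed simp
      then have "(\<integral>\<^sup>+w. ennreal (160 / 9 / D\<^sup>2) * indicator (ball a (r a)) w \<partial>lborel)
          \<le> emeasure M (ball a (r a))"
        unfolding emeasure_M[OF borel_open[OF open_ball]] by (intro nn_integral_mono)
      moreover have "(\<integral>\<^sup>+w. ennreal (160 / 9 / D\<^sup>2) * indicator (ball a (r a)) w \<partial>lborel)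
          = ennreal (160 / 9 / D\<^sup>2 * (pi * (t / 2)\<^sup>2))"
        using t by (subst nn_integral_cmult_indicator)
          (auto simp: emeasure_ball unit_ball_vol_2 r_def t_def simp flip: ennreal_mult)
      ultimately show ?thesis by (simp add: emeasure_eq_measure)
    qed
    moreover have "4 / (25 * t) * measure M (ball a (r a)) \<le> Re (herglotz a)"
      using Re_herglotz_kernel_ge_near_diagonal[OF disk]
      by (intro herglotz_ge_of_kernel_ge[OF disk]) (auto simp: t_def r_def)
    moreover have "Re (herglotz_kernel \<zeta> a) \<le> 2 * t / D\<^sup>2"
    proof -
      have "1 - (cmod a)\<^sup>2 \<le> 2 * t"
        using sum_squares_ge_zero[of t 0] by (simp add: t_def power2_eq_square algebra_simps)
      then show ?thesis
        unfolding Re_herglotz_kernel_unit[OF \<zeta>1] D_def by (intro divide_right_mono) auto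
    qed
    moreover have "2 * t / D\<^sup>2 \<le> 4 / (25 * t) * (160 / 9 / D\<^sup>2 * (pi * (t / 2)\<^sup>2))"
    proof -
      have "2 * t / D\<^sup>2 \<le> (160 / 225 * pi) * (t / D\<^sup>2)"
        using pi_gt3 t mult_right_mono[of 2 "160 / 225 * pi" "t / D\<^sup>2"] by simp
      also have "\<dots> = 4 / (25 * t) * (160 / 9 / D\<^sup>2 * (pi * (t / 2)\<^sup>2))"
        using t by (simp add: power2_eq_square field_simps)
      finally show ?thesis .
    qed
    ultimately show "Re (herglotz_kernel \<zeta> a) \<le> Re (herglotz a)"
      using t mult_left_mono[of "160 / 9 / D\<^sup>2 * (pi * (t / 2)\<^sup>2)" "measure M (ball a (r a))" "4 / (25 * t)"]
      by simp
  qed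
qed

theorem corollary2p4:
  fixes \<Lambda> :: "complex set"
  assumes "\<Lambda> \<subseteq> unit_disk"
    and "sampling_Nevanlinna \<Lambda>"
  shows "Hayman_Lyons_set \<Lambda>"
proof (rule ccontr)
  assume "\<not> Hayman_Lyons_set \<Lambda>"
  then obtain \<zeta> where \<zeta>: "\<zeta> \<in> unit_circle" and "Hayman_Lyons_integral \<Lambda> \<zeta> (1/2) \<noteq> \<infinity>"
    unfolding Hayman_Lyons_set_def by (auto dest!: spec[of _ "1/2"])
  then have "Hayman_Lyons_integral \<Lambda> \<zeta> (1/2) < \<infinity>" by (simp add: top.not_eq_extremum)
  then obtain M where M: "finite_disk_measure M"
    and dom: "\<And>a. a \<in> \<Lambda> \<Longrightarrow> Re (herglotz_kernel \<zeta> a) \<le> Re (finite_disk_measure.herglotz M a)"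
    using Poisson_dominated_by_herglotz[OF assms(1) \<zeta>] by blast
  interpret finite_disk_measure M by (rule M)
  have \<zeta>1: "cmod \<zeta> = 1" using \<zeta> by simp
  define f where "f = (\<lambda>c z. exp (of_real c * (herglotz_kernel \<zeta> z - herglotz z)))"
  have ln_f: "ln (cmod (f c z)) = c * (Re (herglotz_kernel \<zeta> z) - Re (herglotz z))" for c z
    by (simp add: f_def)
  obtain z where z: "z \<in> unit_disk" "Re (herglotz z) < Re (herglotz_kernel \<zeta> z)"
    using herglotz_less_Poisson_radially[OF \<zeta>1] .
  \<comment> \<open>The gap at \<open>z\<close>, transported to 0 by Harnack's inequality.\<close>
  define k where "k = (Re (herglotz_kernel \<zeta> z) - Re (herglotz z)) * (1 - cmod z) / (1 + cmod z)"
  have z1: "cmod z < 1" "0 < 1 + cmod z" using z(1) by (auto simp: add_pos_nonneg)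
  have k: "k > 0" using z z1 by (simp add: k_def)
  have lower: "ereal (c * k) \<le> Nev (f c)" if "0 \<le> c" for c
    unfolding Nev_def
  proof (rule INF_greatest)
    fix h assume "h \<in> {h \<in> Har_plus. \<forall>z\<in>unit_disk. ln (1 + cmod (f c z)) \<le> h z}"
    then have h: "h \<in> Har_plus" "ln (1 + cmod (f c z)) \<le> h z" using z(1) by auto
    have "ln (cmod (f c z)) \<le> ln (1 + cmod (f c z))"
      by (intro ln_mono) (auto simp: f_def)
    then have "c * (Re (herglotz_kernel \<zeta> z) - Re (herglotz z)) \<le> h z" using h(2) ln_f by simp
    then have "c * (Re (herglotz_kernel \<zeta> z) - Re (herglotz z)) * (1 - cmod z) \<le> h z * (1 - cmod z)"
      using z1 by (intro mult_right_mono) auto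
    also have "\<dots> \<le> h 0 * (1 + cmod z)" by (rule Har_plus_Harnack[OF h(1) z(1)])
    finally have "c * k \<le> h 0" using z1(2) by (simp add: k_def pos_divide_le_eq mult.assoc)
    then show "ereal (c * k) \<le> ereal (h 0)" by simp
  qed
  have upper: "Nev_on \<Lambda> (f c) \<le> ereal (ln 2)" if "0 \<le> c" for c
    unfolding Nev_on_def
  proof (rule INF_lower2)
    have "harmonic_on (\<lambda>_. ln 2) unit_disk"
      unfolding harmonic_on_def by (intro exI[of _ "\<lambda>_. 0"]) auto
    moreover have "ln (1 + cmod (f c a)) \<le> ln 2" if "a \<in> \<Lambda>" for a
    proof -
      have "c * (Re (herglotz_kernel \<zeta> a) - Re (herglotz a)) \<le> 0"
        using dom[OF that] \<open>0 \<le> c\<close> by (simp add: mult_nonneg_nonpos)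
      then have "cmod (f c a) \<le> 1" by (simp add: f_def)
      then show ?thesis by (simp add: add_pos_nonneg)
    qed
    ultimately show "(\<lambda>_. ln 2) \<in> {h \<in> Har_plus. \<forall>z\<in>\<Lambda>. ln (1 + cmod (f c z)) \<le> h z}"
      by (simp add: Har_plus_def)
  qed simp
  obtain C where C: "\<And>g. g \<in> Nevanlinna \<Longrightarrow> Nev g \<le> Nev_on \<Lambda> g + ereal C"
    using assms(2) unfolding sampling_Nevanlinna_def by blast
  have bound: "c * k \<le> ln 2 + C" if "0 \<le> c" for c
  proof -
    have "ereal (c * k) \<le> Nev_on \<Lambda> (f c) + ereal C"
      using lower[OF that] C[of "f c"] exp_Poisson_minus_herglotz_Nevanlinna[OF \<zeta>1 that]
      unfolding f_def by (meson order_trans)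
    also have "\<dots> \<le> ereal (ln 2) + ereal C" by (intro add_right_mono upper that)
    finally show ?thesis by simp
  qed
  \<comment> \<open>A value of \<open>c\<close> for which \<open>c k\<close> exceeds \<open>ln 2 + C\<close>.\<close>
  have "((\<bar>ln 2 + C\<bar> + 1) / k) * k \<le> ln 2 + C" by (rule bound) (use k in simp)
  then show False using k by simp
qed

end
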